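(* Let $T_1,T_2,\Delta t>0$ and $\Omega\in\mathbb{R}$. Consider the fourth-order Gregory nested Picard iteration scheme (without trace renormalization) applied to the single-qubit Lindblad test equation, with flow-operator approximation $U^{(4)}(t^{n+k},t^n)=\mathrm{diag}(1,\varsigma^{(4)}(k))$ (either the explicit or the implicit choice), where all these objects and the notion of stability are defined in the context. Set $$B^{(4)}=\sum_{k=0}^{3}\bigl(\omega^{(4)}_5\bigr)^k\left(\frac{\Delta t}{T_2}\right)^k .$$ If all roots $\lambda\in\mathbb{C}$ of the fifth-degree polynomial $$\lambda^5-\sum_{k=1}^{5}\lambda^{5-k}\,\omega^{(4)}_{5-k}\,B^{(4)}\,\frac{\Delta t}{T_2}\left|\varsigma^{(4)}(k)\right|^2-\lambda^4\bigl(\omega^{(4)}_5\bigr)^4\left(\frac{\Delta t}{T_2}\right)^4-B^{(4)}\left|\varsigma^{(4)}(5)\right|^2$$ lie in the unit disk $\{|\lambda|\le 1\}$, and $$\left|\varsigma^{(4)}(5)\right|\le 1,$$ then the fourth-order scheme is stable.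
   Context: Test equation: $\rho(t)\in\mathbb{C}^{2\times 2}$ satisfies the Lindblad equation $\rho'=J\rho+\rho J^\dagger+\mathcal{L}_L\rho$, where $\mathcal{L}_L\rho=\mathcal{L}_1\rho\mathcal{L}_1^\dagger+\mathcal{L}_2\rho\mathcal{L}_2^\dagger$, $^\dagger$ is the conjugate transpose, $$H=\Omega\begin{pmatrix}0&0\\0&1\end{pmatrix},\quad \mathcal{L}_1=\frac{1}{\sqrt{T_1}}\begin{pmatrix}0&1\\0&0\end{pmatrix},\quad \mathcal{L}_2=\frac{1}{\sqrt{T_2}}\begin{pmatrix}0&0\\0&1\end{pmatrix},$$ $$J=-iH-\tfrac12\mathcal{L}_1^\dagger\mathcal{L}_1-\tfrac12\mathcal{L}_2^\dagger\mathcal{L}_2=\begin{pmatrix}0&0\\0&-i\Omega-\frac{1}{2T_1}-\frac{1}{2T_2}\end{pmatrix}.$$ Time grid: $t^n=n\Delta t$. Gregory weights of order 4: $\omega^{(4)}_0=\omega^{(4)}_5=\frac38$, $\omega^{(4)}_1=\omega^{(4)}_4=\frac76$, $\omega^{(4)}_2=\omega^{(4)}_3=\frac{23}{24}$. Flow operator: $U^{(4)}(t^{n+k},t^n)$ is a fourth-order approximation, using one step of length $k\Delta t$, of the flow of $V'=JV$. It is either the explicit one, $$U^{(4)}(t^{n+k},t^n)=I+k\Delta tJ+\tfrac{(k\Delta t)^2}{2}J^2+\tfrac{(k\Delta t)^3}{6}J^3+\tfrac{(k\Delta t)^4}{24}J^4,$$ or the implicit one, $$U^{(4)}(t^{n+k},t^n)=\bigl(I+i\tfrac{k\Delta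 t}{4}\overline{d}J\bigr)^{-1}\bigl(I+i\tfrac{k\Delta t}{4}dJ\bigr)\bigl(I-i\tfrac{k\Delta t}{4}dJ\bigr)^{-1}\bigl(I-i\tfrac{k\Delta t}{4}\overline{d}J\bigr),\qquad d=\tfrac{1}{\sqrt3}-i.$$ In both cases $U^{(4)}(t^{n+k},t^n)=\mathrm{diag}(1,\varsigma^{(4)}(k))$, where, with $A(k)=-\frac k2\frac{\Delta t}{T_1}-\frac k2\frac{\Delta t}{T_2}-ik\Omega\Delta t$, $$\varsigma^{(4)}(k)=1+A(k)+\tfrac12A(k)^2+\tfrac16A(k)^3+\tfrac1{24}A(k)^4\quad\text{(explicit)},$$ $$\varsigma^{(4)}(k)=\frac{(1+i\frac d4A(k))(1-i\frac{\overline d}{4}A(k))}{(1+i\frac{\overline d}{4}A(k))(1-i\frac d4A(k))}\quad\text{(implicit)}.$$ Fourth-order scheme: given $\rho^n,\dots,\rho^{n+4}$, set $\rho^{n+5,0}=\rho^{n+4}$ and, for $k=1,2,3,4$, $$\rho^{n+5,k}=U^{(4)}(t^{n+5},t^n)\rho^nU^{(4)}(t^{n+5},t^n)^\dagger+\Delta t\sum_{j=0}^{4}\omega^{(4)}_jU^{(4)}(t^{n+5},t^{n+j})\bigl(\mathcal{L}_L\rho^{n+j}\bigr)U^{(4)}(t^{n+5},t^{n+j})^\dagger+\Delta t\,\omega^{(4)}_5\mathcal{L}_L\rho^{n+5,k-1},$$ and define $\rho^{n+5}=\rho^{n+5,4}$. No trace renormalization is applied. Stability: the scheme defines a linear map $(\rho^{n+4},\rho^{n+3},\rho^{n+2},\rho^{n+1},\rho^{n})\mapsto(\rho^{n+5},\rho^{n+4},\rho^{n+3},\rho^{n+2},\rho^{n+1})$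 on $(\mathbb{C}^{2\times2})^5$. Its matrix (after vectorizing) is the amplification matrix. The scheme is called stable if the spectral radius of the amplification matrix is at most $1$, i.e. all of its eigenvalues have modulus $\le1$. *)

theory Defs
  imports "HOL-Analysis.Analysis" "Jordan_Normal_Form.Spectral_Radius"
begin

no_notation Matrix.vec_index (infixl \<open>$\<close> 100)

type_synonym cmat2 = "complex^2^2"

text \<open>The juxtaposition of matrices is \<open>**\<close> and the identity matrix is \<open>mat 1\<close>; on this type
  the class operations \<open>*\<close>, \<open>^\<close> and the numeral \<open>1\<close> are entrywise and are not used.
  Multiplication of a matrix by a complex scalar has no constant in the library.\<close>

abbreviation id2 :: cmat2 where
  "id2 \<equiv> Finite_Cartesian_Product.mat 1"

definition cscale :: "complex \<Rightarrow> cmat2 \<Rightarrow> cmat2" (infixr \<open>*\<^sub>C\<close> 75) where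
  "c *\<^sub>C M = map_matrix ((*) c) M"

definition dagger :: "cmat2 \<Rightarrow> cmat2" where
  "dagger M = map_matrix cnj (Finite_Cartesian_Product.transpose M)"


section \<open>The Lindblad test equation\<close>

definition hamiltonian :: "real \<Rightarrow> cmat2" where
  "hamiltonian \<Omega> = \<Omega> *\<^sub>R vector [vector [0, 0], vector [0, 1]]"

definition lindblad1 :: "real \<Rightarrow> cmat2" where
  "lindblad1 T1 = (1 / sqrt T1) *\<^sub>R vector [vector [0, 1], vector [0, 0]]"

definition lindblad2 :: "real \<Rightarrow> cmat2" where
  "lindblad2 T2 = (1 / sqrt T2) *\<^sub>R vector [vector [0, 0], vector [0, 1]]"

definition J_op :: "real \<Rightarrow> real \<Rightarrow> real \<Rightarrow> cmat2" where
  "J_op T1 T2 \<Omega> =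
     - (\<i> *\<^sub>C hamiltonian \<Omega>)
     - (1/2) *\<^sub>R (dagger (lindblad1 T1) ** lindblad1 T1)
     - (1/2) *\<^sub>R (dagger (lindblad2 T2) ** lindblad2 T2)"

definition jump :: "real \<Rightarrow> real \<Rightarrow> cmat2 \<Rightarrow> cmat2" where
  "jump T1 T2 \<rho> =
     lindblad1 T1 ** \<rho> ** dagger (lindblad1 T1) + lindblad2 T2 ** \<rho> ** dagger (lindblad2 T2)"


section \<open>Fourth-order flow operators\<close>

datatype flow_kind = Explicit | Implicit

definition d_const :: complex where
  "d_const = of_real (1 / sqrt 3) - \<i>"

text \<open>One step of length \<open>h\<close> for \<open>V' = M V\<close>. The operator from \<open>t\<^sup>n\<close> to \<open>t\<^sup>n\<^sup>+\<^sup>k\<close> has \<open>h = k \<Delta>t\<close>.\<close>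

fun flow_step :: "flow_kind \<Rightarrow> cmat2 \<Rightarrow> real \<Rightarrow> cmat2" where
  "flow_step Explicit M h =
     id2 + h *\<^sub>R M + (h^2 / 2) *\<^sub>R (M ** M) + (h^3 / 6) *\<^sub>R (M ** M ** M)
       + (h^4 / 24) *\<^sub>R (M ** M ** M ** M)"
| "flow_step Implicit M h =
     matrix_inv (id2 + (\<i> * of_real (h / 4) * cnj d_const) *\<^sub>C M)
       ** (id2 + (\<i> * of_real (h / 4) * d_const) *\<^sub>C M)
       ** matrix_inv (id2 - (\<i> * of_real (h / 4) * d_const) *\<^sub>C M)
       ** (id2 - (\<i> * of_real (h / 4) * cnj d_const) *\<^sub>C M)"

definition flow :: "flow_kind \<Rightarrow> real \<Rightarrow> real \<Rightarrow> real \<Rightarrow> real \<Rightarrow> nat \<Rightarrow> cmat2" where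
  "flow m T1 T2 \<Omega> \<Delta>t k = flow_step m (J_op T1 T2 \<Omega>) (real k * \<Delta>t)"

definition A_const :: "real \<Rightarrow> real \<Rightarrow> real \<Rightarrow> real \<Rightarrow> nat \<Rightarrow> complex" where
  "A_const T1 T2 \<Omega> \<Delta>t k =
     - of_real (real k / 2 * (\<Delta>t / T1)) - of_real (real k / 2 * (\<Delta>t / T2))
     - \<i> * of_real (real k * \<Omega> * \<Delta>t)"

fun stability_factor :: "flow_kind \<Rightarrow> real \<Rightarrow> real \<Rightarrow> real \<Rightarrow> real \<Rightarrow> nat \<Rightarrow> complex" where
  "stability_factor Explicit T1 T2 \<Omega> \<Delta>t k =
     (let A = A_const T1 T2 \<Omega> \<Delta>t k in 1 + A + A^2 / 2 + A^3 / 6 + A^4 / 24)"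
| "stability_factor Implicit T1 T2 \<Omega> \<Delta>t k =
     (let A = A_const T1 T2 \<Omega> \<Delta>t k in
        ((1 + \<i> * (d_const / 4) * A) * (1 - \<i> * (cnj d_const / 4) * A))
      / ((1 + \<i> * (cnj d_const / 4) * A) * (1 - \<i> * (d_const / 4) * A)))"


section \<open>The scheme\<close>

text \<open>Only the indices 0 to 5 are meaningful.\<close>

definition gregory_weight :: "nat \<Rightarrow> real" where
  "gregory_weight j = [3/8, 7/6, 23/24, 23/24, 7/6, 3/8] ! j"

text \<open>The argument \<open>\<rho> j\<close> stands for \<open>\<rho>\<^sup>n\<^sup>+\<^sup>j\<close>, \<open>j \<le> 4\<close>, and the last argument counts the Picard iterations.\<close>

primrec picard_iterate ::
  "flow_kind \<Rightarrow> real \<Rightarrow> real \<Rightarrow> real \<Rightarrow> real \<Rightarrow> (nat \<Rightarrow> cmat2) \<Rightarrow> nat \<Rightarrow> cmat2" where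
  "picard_iterate m T1 T2 \<Omega> \<Delta>t \<rho> 0 = \<rho> 4"
| "picard_iterate m T1 T2 \<Omega> \<Delta>t \<rho> (Suc k) =
     (let U = flow m T1 T2 \<Omega> \<Delta>t in
        U 5 ** \<rho> 0 ** dagger (U 5)
      + \<Delta>t *\<^sub>R (\<Sum>j=0..4. gregory_weight j *\<^sub>R (U (5 - j) ** jump T1 T2 (\<rho> j) ** dagger (U (5 - j))))
      + (\<Delta>t * gregory_weight 5) *\<^sub>R jump T1 T2 (picard_iterate m T1 T2 \<Omega> \<Delta>t \<rho> k))"

text \<open>The time levels of a state, latest first: \<open>(\<rho>\<^sup>n\<^sup>+\<^sup>4, \<rho>\<^sup>n\<^sup>+\<^sup>3, \<rho>\<^sup>n\<^sup>+\<^sup>2, \<rho>\<^sup>n\<^sup>+\<^sup>1, \<rho>\<^sup>n)\<close>.\<close>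

type_synonym levels = "cmat2 \<times> cmat2 \<times> cmat2 \<times> cmat2 \<times> cmat2"

fun scheme_map :: "flow_kind \<Rightarrow> real \<Rightarrow> real \<Rightarrow> real \<Rightarrow> real \<Rightarrow> levels \<Rightarrow> levels" where
  "scheme_map m T1 T2 \<Omega> \<Delta>t (r4, r3, r2, r1, r0) =
     (picard_iterate m T1 T2 \<Omega> \<Delta>t (\<lambda>j. [r0, r1, r2, r3, r4] ! j) 4, r4, r3, r2, r1)"


section \<open>Amplification matrix and stability\<close>

text \<open>Vectorization stacks the columns of each matrix, level after level.\<close>

definition vec_list :: "cmat2 \<Rightarrow> complex list" where
  "vec_list M = [M $ 1 $ 1, M $ 2 $ 1, M $ 1 $ 2, M $ 2 $ 2]"

fun vectorize :: "levels \<Rightarrow> complex Matrix.vec" where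
  "vectorize (r4, r3, r2, r1, r0) =
     vec_of_list (vec_list r4 @ vec_list r3 @ vec_list r2 @ vec_list r1 @ vec_list r0)"

definition unvec_block :: "complex Matrix.vec \<Rightarrow> nat \<Rightarrow> cmat2" where
  "unvec_block v b =
     vector [vector [vec_index v (4 * b),     vec_index v (4 * b + 2)],
             vector [vec_index v (4 * b + 1), vec_index v (4 * b + 3)]]"

definition unvectorize :: "complex Matrix.vec \<Rightarrow> levels" where
  "unvectorize v =
     (unvec_block v 0, unvec_block v 1, unvec_block v 2, unvec_block v 3, unvec_block v 4)"

definition amplification_matrix ::
  "flow_kind \<Rightarrow> real \<Rightarrow> real \<Rightarrow> real \<Rightarrow> real \<Rightarrow> complex Matrix.mat" where
  "amplification_matrix m T1 T2 \<Omega> \<Delta>t =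
     Matrix.mat 20 20 (\<lambda>(r, c).
       vec_index (vectorize (scheme_map m T1 T2 \<Omega> \<Delta>t (unvectorize (unit_vec 20 c)))) r)"

definition scheme_stable :: "flow_kind \<Rightarrow> real \<Rightarrow> real \<Rightarrow> real \<Rightarrow> real \<Rightarrow> bool" where
  "scheme_stable m T1 T2 \<Omega> \<Delta>t \<longleftrightarrow> spectral_radius (amplification_matrix m T1 T2 \<Omega> \<Delta>t) \<le> 1"

definition B_const :: "real \<Rightarrow> real \<Rightarrow> real" where
  "B_const T2 \<Delta>t = (\<Sum>k=0..3. gregory_weight 5 ^ k * (\<Delta>t / T2) ^ k)"

end

theory Submission
  imports Defs
begin

text \<open>The scheme decouples entry by entry. The generator \<open>J\<close> is diagonal with first entry 0, so every
  flow operator is \<open>diag(1, s)\<close> (\<open>flow_diag2\<close>), and conjugation by it multiplies the four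
  entries of a density matrix by 1, \<open>cnj s\<close>, \<open>s\<close> and \<open>|s|\<^sup>2\<close>. The jump term is diagonal and reads only
  the excited population, the (2,2) entry. Hence the (2,2) entries evolve among themselves, each
  off-diagonal entry evolves alone, and the (1,1) entry depends on itself and the (2,2) entries: the
  amplification matrix is block triangular.

  An eigenvector for \<open>z\<close> consists of five levels \<open>\<rho>, z \<rho>, \<dots>, z\<^sup>4 \<rho>\<close> with \<open>\<rho> \<noteq> 0\<close> whose successor is
  \<open>z\<^sup>5 \<rho>\<close> (\<open>eigenvalue_levels\<close>). If the (2,2) entry of \<open>\<rho>\<close> is nonzero, dividing the (2,2) recurrence
  by it shows that \<open>z\<close> is a root of the polynomial in the hypothesis. The four Picard iterations are
  an affine recursion with ratio \<open>q = \<omega>\<^sub>5 \<Delta>t / T2\<close>, started at the latest level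
  (\<open>picard_22\<close>): the geometric sum of \<open>q\<close> is the factor \<open>B\<close>, and \<open>q\<^sup>4\<close> multiplies the start value, which
  explains the separate \<open>z\<^sup>4\<close> term. If the (2,2) entry vanishes, the jump term drops out, and a nonzero
  remaining entry forces \<open>z\<^sup>5\<close> to be \<open>s\<close>, \<open>cnj s\<close> or 1, where \<open>s\<close> is the stability factor of five steps,
  of modulus at most 1.\<close>

section \<open>Diagonal two-by-two matrices\<close>

definition diag2 :: "complex \<Rightarrow> complex \<Rightarrow> cmat2" where
  "diag2 a b = vector [vector [a, 0], vector [0, b]]"

lemma diag2_nth [simp]:
  "diag2 a b $ 1 $ 1 = a" "diag2 a b $ 1 $ 2 = 0"
  "diag2 a b $ 2 $ 1 = 0" "diag2 a b $ 2 $ 2 = b"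
  by (simp_all add: diag2_def)

lemma cmat2_eqI:
  fixes M N :: cmat2
  assumes "M $ 1 $ 1 = N $ 1 $ 1" "M $ 1 $ 2 = N $ 1 $ 2"
    "M $ 2 $ 1 = N $ 2 $ 1" "M $ 2 $ 2 = N $ 2 $ 2"
  shows "M = N"
  using assms by (simp add: Finite_Cartesian_Product.vec_eq_iff forall_2)

lemma mult_nth: "((M :: cmat2) ** N) $ i $ j = M $ i $ 1 * N $ 1 $ j + M $ i $ 2 * N $ 2 $ j"
  by (simp add: matrix_matrix_mult_def sum_2)

lemma cscale_nth [simp]: "(c *\<^sub>C M) $ i $ j = c * M $ i $ j"
  by (simp add: cscale_def map_matrix_def)

lemma dagger_nth [simp]: "dagger M $ i $ j = cnj (M $ j $ i)"
  by (simp add: dagger_def map_matrix_def Finite_Cartesian_Product.transpose_def)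

lemma id2_diag2: "id2 = diag2 1 1"
  by (rule cmat2_eqI) (simp_all add: Finite_Cartesian_Product.mat_def)

lemma diag2_mult: "diag2 a b ** diag2 c d = diag2 (a * c) (b * d)"
  by (rule cmat2_eqI) (simp_all add: mult_nth)

lemma diag2_add: "diag2 a b + diag2 c d = diag2 (a + c) (b + d)"
  by (rule cmat2_eqI) simp_all

lemma diag2_diff: "diag2 a b - diag2 c d = diag2 (a - c) (b - d)"
  by (rule cmat2_eqI) simp_all

lemma diag2_scaleR: "r *\<^sub>R diag2 a b = diag2 (r *\<^sub>R a) (r *\<^sub>R b)"
  by (rule cmat2_eqI) simp_all

lemma diag2_cscale: "c *\<^sub>C diag2 a b = diag2 (c * a) (c * b)"
  by (rule cmat2_eqI) simp_all

lemma diag2_inv: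
  assumes "a \<noteq> 0" "b \<noteq> 0"
  shows "matrix_inv (diag2 a b) = diag2 (inverse a) (inverse b)"
proof -
  let ?A = "diag2 a b" and ?B = "diag2 (inverse a) (inverse b)"
  have AB: "?A ** ?B = id2" "?B ** ?A = id2"
    using assms by (simp_all add: diag2_mult id2_diag2)
  have "X = ?B" if "?A ** X = id2" for X
    using that AB(2) by (metis matrix_mul_assoc matrix_mul_lid matrix_mul_rid)
  then show ?thesis
    unfolding matrix_inv_def using AB by (intro some_equality) blast+
qed

lemmas diag2_simps =
  id2_diag2 diag2_mult diag2_add diag2_diff diag2_scaleR diag2_cscale diag2_inv

lemma diag2_conj_nth:
  "(diag2 1 s ** M ** dagger (diag2 1 s)) $ 1 $ 1 = M $ 1 $ 1"
  "(diag2 1 s ** M ** dagger (diag2 1 s)) $ 1 $ 2 = cnj s * M $ 1 $ 2"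
  "(diag2 1 s ** M ** dagger (diag2 1 s)) $ 2 $ 1 = s * M $ 2 $ 1"
  "(diag2 1 s ** M ** dagger (diag2 1 s)) $ 2 $ 2 = of_real ((cmod s)\<^sup>2) * M $ 2 $ 2"
  by (simp_all add: mult_nth complex_norm_square[unfolded of_real_power] mult_ac)


section \<open>The operators of the test equation\<close>

text \<open>The lower right entry of the diagonal generator \<open>J\<close>.\<close>

definition J_rate :: "real \<Rightarrow> real \<Rightarrow> real \<Rightarrow> complex" where
  "J_rate T1 T2 \<Omega> = - \<i> * of_real \<Omega> - of_real (1 / (2 * T1)) - of_real (1 / (2 * T2))"

lemma J_op_diag2:
  assumes "T1 > 0" "T2 > 0"
  shows "J_op T1 T2 \<Omega> = diag2 0 (J_rate T1 T2 \<Omega>)"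
proof -
  have s: "of_real (sqrt T) * of_real (sqrt T) = (of_real T :: complex)" if "T > 0" for T
    using that by (simp flip: of_real_mult)
  show ?thesis
    by (rule cmat2_eqI)
      (use assms in \<open>simp_all add: J_op_def hamiltonian_def lindblad1_def lindblad2_def mult_nth
         J_rate_def scaleR_conv_of_real[where 'a = complex] s field_simps\<close>)
qed

lemma jump_diag2:
  assumes "T1 > 0" "T2 > 0"
  shows "jump T1 T2 \<rho> = diag2 (of_real (1 / T1) * \<rho> $ 2 $ 2) (of_real (1 / T2) * \<rho> $ 2 $ 2)"
proof -
  have s: "of_real (sqrt T) * of_real (sqrt T) = (of_real T :: complex)" if "T > 0" for T
    using that by (simp flip: of_real_mult)
  show ?thesis
    by (rule cmat2_eqI)
      (use assms in \<open>simp_all add: jump_def lindblad1_def lindblad2_def mult_nth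
         scaleR_conv_of_real[where 'a = complex] s field_simps\<close>)
qed

lemma A_const_eq: "A_const T1 T2 \<Omega> \<Delta>t k = of_real (real k * \<Delta>t) * J_rate T1 T2 \<Omega>"
  by (simp add: A_const_def J_rate_def algebra_simps)

text \<open>Dissipation: this sign is what keeps the denominators of the implicit flow away from 0.\<close>

lemma Re_A_const_nonpos:
  assumes "T1 > 0" "T2 > 0" "\<Delta>t > 0"
  shows "Re (A_const T1 T2 \<Omega> \<Delta>t k) \<le> 0"
proof -
  have "0 \<le> real k / 2 * (\<Delta>t / T1)" "0 \<le> real k / 2 * (\<Delta>t / T2)"
    using assms by simp_all
  then show ?thesis
    by (simp add: A_const_def del: mult_nonneg_nonneg)
qed

text \<open>The implicit step is a diagonal Pade approximation of the exponential, whose poles lie in the right half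
  plane. Concretely, the two denominators have the form \<open>1 - c * A\<close> with \<open>Re c = 1/4\<close>, so that they
  vanish only at \<open>A = inverse c\<close>, a point of positive real part.\<close>

lemma implicit_denominators_nonzero:
  assumes "Re A \<le> 0"
  shows "1 + \<i> * (cnj d_const / 4) * A \<noteq> 0" and "1 - \<i> * (d_const / 4) * A \<noteq> 0"
proof -
  have *: "1 - c * A \<noteq> 0" if "Re c > 0" for c
  proof
    assume "1 - c * A = 0"
    then have "A = inverse c"
      using that by (metis eq_iff_diff_eq_0 inverse_unique)
    then have "Re A = Re c / ((Re c)\<^sup>2 + (Im c)\<^sup>2)"
      by simp
    moreover have "\<dots> > 0"
      using that by (intro divide_pos_pos add_pos_nonneg) auto
    ultimately show False
      using assms by simp
  qed
  from *[of "- (\<i> * (cnj d_const / 4))"] show "1 + \<i> * (cnj d_const / 4) * A \<noteq> 0"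
    by (simp add: d_const_def)
  from *[of "\<i> * (d_const / 4)"] show "1 - \<i> * (d_const / 4) * A \<noteq> 0"
    by (simp add: d_const_def)
qed

lemma flow_diag2:
  assumes "T1 > 0" "T2 > 0" "\<Delta>t > 0"
  shows "flow m T1 T2 \<Omega> \<Delta>t k = diag2 1 (stability_factor m T1 T2 \<Omega> \<Delta>t k)"
proof (cases m)
  case Explicit
  show ?thesis
    unfolding flow_def Explicit J_op_diag2[OF assms(1,2)] flow_step.simps stability_factor.simps
      Let_def A_const_eq
    by (simp add: diag2_simps scaleR_conv_of_real[where 'a = complex] power_mult_distrib
        power2_eq_square power3_eq_cube power4_eq_xxxx mult_ac)
next
  case Implicit
  define A where "A = A_const T1 T2 \<Omega> \<Delta>t k"
  define a where "a = real k * \<Delta>t / 4"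
  have *: "\<i> * of_real a * c * J_rate T1 T2 \<Omega> = \<i> * (c / 4) * A" for c
    by (simp add: A_def A_const_eq a_def)
  have "Re A \<le> 0"
    using Re_A_const_nonpos[OF assms] by (simp add: A_def)
  note nz = implicit_denominators_nonzero[OF this]
  have quotient: "inverse p * q * inverse r * s = (q * s) / (p * r)" for p q r s :: complex
    by (simp add: divide_inverse mult_ac)
  have "flow m T1 T2 \<Omega> \<Delta>t k
      = matrix_inv (diag2 1 (1 + \<i> * (cnj d_const / 4) * A)) ** diag2 1 (1 + \<i> * (d_const / 4) * A)
        ** matrix_inv (diag2 1 (1 - \<i> * (d_const / 4) * A)) ** diag2 1 (1 - \<i> * (cnj d_const / 4) * A)"
    unfolding flow_def Implicit J_op_diag2[OF assms(1,2)] flow_step.simps a_def[symmetric]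
      id2_diag2 diag2_cscale * diag2_add diag2_diff
    by (simp only: mult_zero_right add_0_right diff_zero)
  also have "\<dots> = diag2 1 (((1 + \<i> * (d_const / 4) * A) * (1 - \<i> * (cnj d_const / 4) * A))
      / ((1 + \<i> * (cnj d_const / 4) * A) * (1 - \<i> * (d_const / 4) * A)))"
    by (simp only: diag2_inv[OF one_neq_zero nz(1)] diag2_inv[OF one_neq_zero nz(2)]
        diag2_mult quotient inverse_1 mult_1)
  finally show ?thesis
    by (simp only: Implicit stability_factor.simps Let_def A_def)
qed


section \<open>The Picard iterates entry by entry\<close>

text \<open>The part of a Picard step for the (2,2) entry that uses only the known levels \<open>x 0, \<dots>, x 4\<close> and hence
  is the same in every iteration.\<close>

definition population_update :: "flow_kind \<Rightarrow> real \<Rightarrow> real \<Rightarrow> real \<Rightarrow> real \<Rightarrow> (nat \<Rightarrow> complex) \<Rightarrow> complex" where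
  "population_update m T1 T2 \<Omega> \<Delta>t x =
     of_real ((cmod (stability_factor m T1 T2 \<Omega> \<Delta>t 5))\<^sup>2) * x 0
     + (\<Sum>j=0..4. of_real (gregory_weight j * (\<Delta>t / T2)
                     * (cmod (stability_factor m T1 T2 \<Omega> \<Delta>t (5 - j)))\<^sup>2) * x j)"

context
  fixes T1 T2 \<Delta>t \<Omega> :: real and m :: flow_kind
  assumes pos: "T1 > 0" "T2 > 0" "\<Delta>t > 0"
begin

lemma picard_Suc_offdiagonal:
  "picard_iterate m T1 T2 \<Omega> \<Delta>t \<rho> (Suc k) $ 1 $ 2
     = cnj (stability_factor m T1 T2 \<Omega> \<Delta>t 5) * \<rho> 0 $ 1 $ 2"
  "picard_iterate m T1 T2 \<Omega> \<Delta>t \<rho> (Suc k) $ 2 $ 1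
     = stability_factor m T1 T2 \<Omega> \<Delta>t 5 * \<rho> 0 $ 2 $ 1"
  by (simp_all add: Let_def flow_diag2[OF pos] diag2_conj_nth jump_diag2[OF pos(1,2)])

lemma picard_Suc_11:
  "picard_iterate m T1 T2 \<Omega> \<Delta>t \<rho> (Suc k) $ 1 $ 1
     = \<rho> 0 $ 1 $ 1 + (\<Sum>j=0..4. of_real (\<Delta>t / T1 * gregory_weight j) * \<rho> j $ 2 $ 2)
       + of_real (\<Delta>t / T1 * gregory_weight 5) * picard_iterate m T1 T2 \<Omega> \<Delta>t \<rho> k $ 2 $ 2"
  by (simp add: Let_def flow_diag2[OF pos] diag2_conj_nth jump_diag2[OF pos(1,2)]
      scaleR_conv_of_real[where 'a = complex] sum_distrib_left mult_ac)

lemma picard_Suc_22: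
  "picard_iterate m T1 T2 \<Omega> \<Delta>t \<rho> (Suc k) $ 2 $ 2
     = population_update m T1 T2 \<Omega> \<Delta>t (\<lambda>j. \<rho> j $ 2 $ 2)
       + of_real (gregory_weight 5 * (\<Delta>t / T2)) * picard_iterate m T1 T2 \<Omega> \<Delta>t \<rho> k $ 2 $ 2"
  by (simp add: Let_def flow_diag2[OF pos] diag2_conj_nth jump_diag2[OF pos(1,2)]
      scaleR_conv_of_real[where 'a = complex] sum_distrib_left mult_ac population_update_def)

text \<open>Each iteration is the affine map \<open>x \<mapsto> P + q * x\<close> with a fixed \<open>P\<close>, so that \<open>k\<close> iterations give a
  geometric sum times \<open>P\<close> plus \<open>q ^ k\<close> times the start value.\<close>

lemma picard_22:
  "picard_iterate m T1 T2 \<Omega> \<Delta>t \<rho> k $ 2 $ 2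
     = of_real (\<Sum>i<k. (gregory_weight 5 * (\<Delta>t / T2)) ^ i)
         * population_update m T1 T2 \<Omega> \<Delta>t (\<lambda>j. \<rho> j $ 2 $ 2)
       + of_real ((gregory_weight 5 * (\<Delta>t / T2)) ^ k) * \<rho> 4 $ 2 $ 2"
proof (induction k)
  case 0
  show ?case by simp
next
  case (Suc k)
  define q where "q = gregory_weight 5 * (\<Delta>t / T2)"
  have geometric: "(\<Sum>i<Suc k. q ^ i) = 1 + q * (\<Sum>i<k. q ^ i)"
    unfolding sum.lessThan_Suc_shift by (simp add: sum_distrib_left)
  show ?case
    unfolding picard_Suc_22 Suc.IH q_def[symmetric] geometric by (simp add: algebra_simps)
qed

end

lemma B_const_eq: "B_const T2 \<Delta>t = (\<Sum>i<4. (gregory_weight 5 * (\<Delta>t / T2)) ^ i)"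
proof -
  have "{0..3} = {..<4::nat}" by auto
  then show ?thesis
    unfolding B_const_def by (simp only: power_mult_distrib)
qed


section \<open>The amplification matrix acts as the scheme\<close>

text \<open>The amplification matrix is given by its columns, the images of the unit vectors. To know that it acts
  as the scheme on every vector, it suffices that each coordinate of the scheme is a linear form; the
  encoding by coefficients makes the closure properties and the evaluation at unit vectors short.\<close>

definition linear_form :: "nat \<Rightarrow> (complex Matrix.vec \<Rightarrow> complex) \<Rightarrow> bool" where
  "linear_form n f \<longleftrightarrow>
     (\<exists>a. \<forall>v\<in>carrier_vec n. f v = (\<Sum>c<n. a c * vec_index v c))"

lemma linear_form_unit:
  assumes "linear_form n f" "v \<in> carrier_vec n"
  shows "f v = (\<Sum>c<n. f (unit_vec n c) * vec_index v c)"
proof -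
  obtain a where a: "\<And>v. v \<in> carrier_vec n \<Longrightarrow> f v = (\<Sum>c<n. a c * vec_index v c)"
    using assms(1) by (auto simp: linear_form_def)
  have "f (unit_vec n c) = a c" if "c < n" for c
  proof -
    have "f (unit_vec n c) = (\<Sum>i<n. if i = c then a i else 0)"
      unfolding a[OF unit_vec_carrier] by (intro sum.cong) (use that in auto)
    also have "\<dots> = a c"
      using that by simp
    finally show ?thesis .
  qed
  then show ?thesis
    by (simp add: a[OF assms(2)])
qed

lemma linear_form_index:
  assumes "i < n"
  shows "linear_form n (\<lambda>v. vec_index v i)"
proof -
  have "vec_index v i = (\<Sum>c<n. (if c = i then 1 else 0) * vec_index v c)" for v :: "complex Matrix.vec"
    using assms by (simp add: if_distrib[of "\<lambda>x. x * _"] cong: if_cong)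
  then show ?thesis
    unfolding linear_form_def by (intro exI[of _ "\<lambda>c. if c = i then 1 else 0"] ballI)
qed

lemma linear_form_add:
  assumes "linear_form n f" "linear_form n g"
  shows "linear_form n (\<lambda>v. f v + g v)"
proof -
  obtain a b where
    "\<And>v. v \<in> carrier_vec n \<Longrightarrow> f v = (\<Sum>c<n. a c * vec_index v c)"
    "\<And>v. v \<in> carrier_vec n \<Longrightarrow> g v = (\<Sum>c<n. b c * vec_index v c)"
    using assms by (auto simp: linear_form_def)
  then show ?thesis
    unfolding linear_form_def
    by (intro exI[of _ "\<lambda>c. a c + b c"]) (simp add: sum.distrib distrib_right)
qed

lemma linear_form_scale:
  assumes "linear_form n f"
  shows "linear_form n (\<lambda>v. k * f v)"
proof -
  obtain a where "\<And>v. v \<in> carrier_vec n \<Longrightarrow> f v = (\<Sum>c<n. a c * vec_index v c)"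
    using assms by (auto simp: linear_form_def)
  then show ?thesis
    unfolding linear_form_def
    by (intro exI[of _ "\<lambda>c. k * a c"]) (simp add: sum_distrib_left mult.assoc)
qed

lemma linear_form_sum:
  assumes "finite I" "\<And>i. i \<in> I \<Longrightarrow> linear_form n (f i)"
  shows "linear_form n (\<lambda>v. \<Sum>i\<in>I. f i v)"
  using assms
proof (induction I rule: finite_induct)
  case empty
  have "linear_form n (\<lambda>v. 0)"
    unfolding linear_form_def by (intro exI[of _ "\<lambda>_. 0"]) simp
  then show ?case by simp
qed (auto intro: linear_form_add)

lemma unvec_block_nth [simp]:
  "unvec_block v b $ 1 $ 1 = vec_index v (4 * b)"
  "unvec_block v b $ 2 $ 1 = vec_index v (4 * b + 1)"
  "unvec_block v b $ 1 $ 2 = vec_index v (4 * b + 2)"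
  "unvec_block v b $ 2 $ 2 = vec_index v (4 * b + 3)"
  by (simp_all add: unvec_block_def)

text \<open>The time levels stored in a vector, oldest first: the blocks of the vectorization are ordered latest
  first, so the order is reversed.\<close>

definition level :: "complex Matrix.vec \<Rightarrow> nat \<Rightarrow> cmat2" where
  "level v j = [unvec_block v 4, unvec_block v 3, unvec_block v 2, unvec_block v 1, unvec_block v 0] ! j"

lemma level_eq: "j \<le> 4 \<Longrightarrow> level v j = unvec_block v (4 - j)"
  by (auto simp: level_def le_Suc_eq numeral_eq_Suc)

definition scheme_form ::
  "flow_kind \<Rightarrow> real \<Rightarrow> real \<Rightarrow> real \<Rightarrow> real \<Rightarrow> complex Matrix.vec \<Rightarrow> nat \<Rightarrow> complex" where
  "scheme_form m T1 T2 \<Omega> \<Delta>t v r = vec_index (vectorize (scheme_map m T1 T2 \<Omega> \<Delta>t (unvectorize v))) r"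

text \<open>One step of the scheme moves every stored level but the oldest one block further; only the first
  block is new.\<close>

lemma scheme_form_shift:
  assumes "4 \<le> r" "r < 20"
  shows "scheme_form m T1 T2 \<Omega> \<Delta>t v r = vec_index v (r - 4)"
proof -
  have "r \<in> set [4..<20]"
    using assms by (simp only: set_upt atLeastLessThan_iff)
  then show ?thesis
    by (auto simp: scheme_form_def unvectorize_def vec_list_def vec_of_list_index
        numeral_2_eq_2 simp del: vec_of_list_Cons)
qed

lemma scheme_form_head:
  "scheme_form m T1 T2 \<Omega> \<Delta>t v 0 = picard_iterate m T1 T2 \<Omega> \<Delta>t (level v) 4 $ 1 $ 1"
  "scheme_form m T1 T2 \<Omega> \<Delta>t v 1 = picard_iterate m T1 T2 \<Omega> \<Delta>t (level v) 4 $ 2 $ 1"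
  "scheme_form m T1 T2 \<Omega> \<Delta>t v 2 = picard_iterate m T1 T2 \<Omega> \<Delta>t (level v) 4 $ 1 $ 2"
  "scheme_form m T1 T2 \<Omega> \<Delta>t v 3 = picard_iterate m T1 T2 \<Omega> \<Delta>t (level v) 4 $ 2 $ 2"
  by (simp_all add: scheme_form_def unvectorize_def vec_list_def vec_of_list_index
      level_def[abs_def] del: vec_of_list_Cons picard_iterate.simps)

context
  fixes T1 T2 \<Delta>t \<Omega> :: real and m :: flow_kind
  assumes pos: "T1 > 0" "T2 > 0" "\<Delta>t > 0"
begin

lemma linear_form_level_22: "j \<le> 4 \<Longrightarrow> linear_form 20 (\<lambda>v. level v j $ 2 $ 2)"
  by (simp add: level_eq) (rule linear_form_index, simp)

lemma linear_form_picard_22: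
  "linear_form 20 (\<lambda>v. picard_iterate m T1 T2 \<Omega> \<Delta>t (level v) k $ 2 $ 2)"
  unfolding picard_22[OF pos] population_update_def
  by (intro linear_form_add linear_form_scale linear_form_sum linear_form_level_22) auto

lemma linear_form_scheme:
  assumes "r < 20"
  shows "linear_form 20 (\<lambda>v. scheme_form m T1 T2 \<Omega> \<Delta>t v r)"
proof -
  have four: "4 = Suc 3" by simp
  consider "r = 0" | "r = 1" | "r = 2" | "r = 3" | "4 \<le> r"
    by linarith
  then show ?thesis
  proof cases
    assume "r = 0"
    have "linear_form 20 (\<lambda>v. level v 0 $ 1 $ 1)"
      by (simp add: level_eq linear_form_index)
    then show ?thesis
      unfolding \<open>r = 0\<close> scheme_form_head four picard_Suc_11[OF pos]
      by (intro linear_form_add linear_form_scale linear_form_sum linear_form_level_22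
          linear_form_picard_22) auto
  next
    assume "r = 1"
    have "linear_form 20 (\<lambda>v. level v 0 $ 2 $ 1)"
      by (simp add: level_eq linear_form_index)
    then show ?thesis
      unfolding \<open>r = 1\<close> scheme_form_head four picard_Suc_offdiagonal[OF pos]
      by (intro linear_form_scale)
  next
    assume "r = 2"
    have "linear_form 20 (\<lambda>v. level v 0 $ 1 $ 2)"
      by (simp add: level_eq linear_form_index)
    then show ?thesis
      unfolding \<open>r = 2\<close> scheme_form_head four picard_Suc_offdiagonal[OF pos]
      by (intro linear_form_scale)
  next
    assume "r = 3"
    then show ?thesis
      unfolding \<open>r = 3\<close> scheme_form_head by (intro linear_form_picard_22)
  next
    assume "4 \<le> r"
    then show ?thesis
      using assms by (simp add: scheme_form_shift linear_form_index)
  qed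
qed

lemma amplification_matrix_mult:
  assumes "v \<in> carrier_vec 20" "r < 20"
  shows "vec_index (amplification_matrix m T1 T2 \<Omega> \<Delta>t *\<^sub>v v) r = scheme_form m T1 T2 \<Omega> \<Delta>t v r"
  using linear_form_unit[OF linear_form_scheme[OF assms(2)] assms(1)] assms
  by (simp add: amplification_matrix_def scalar_prod_def atLeast0LessThan scheme_form_def
      del: scheme_map.simps vectorize.simps)

end

text \<open>The shift part of the eigenvalue equation says that each stored level is \<open>z\<close> times the one before it in
  time.\<close>

lemma level_geometric:
  assumes shift: "\<And>r. \<lbrakk>4 \<le> r; r < 20\<rbrakk> \<Longrightarrow> vec_index v (r - 4) = z * vec_index v r"
    and "j \<le> 4"
  shows "level v j = z ^ j *\<^sub>C level v 0"
  using \<open>j \<le> 4\<close>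
proof (induction j)
  case 0
  show ?case by (rule cmat2_eqI) simp_all
next
  case (Suc j)
  have sh: "vec_index v (4 * (3 - j) + i) = z * vec_index v (4 * (4 - j) + i)" if "i < 4" for i
  proof -
    have "4 * (4 - j) + i < 20" and e: "4 * (3 - j) + i = 4 * (4 - j) + i - 4"
      and "4 \<le> 4 * (4 - j) + i"
      using that Suc.prems by auto
    then show ?thesis
      unfolding e by (intro shift)
  qed
  have "level v (Suc j) = z *\<^sub>C level v j"
    by (rule cmat2_eqI)
      (use Suc.prems sh[of 0] sh[of 1] sh[of 2] sh[of 3] in \<open>simp_all add: level_eq\<close>)
  also have "\<dots> = z ^ Suc j *\<^sub>C level v 0"
    using Suc by (intro cmat2_eqI) simp_all
  finally show ?case .
qed

lemma vec_zero_if_levels_zero: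
  assumes "v \<in> carrier_vec 20" "\<And>j. j \<le> 4 \<Longrightarrow> level v j = 0"
  shows "v = 0\<^sub>v 20"
proof (rule eq_vecI)
  fix r assume "r < dim_vec (0\<^sub>v 20)"
  then have r: "r < 20" by simp
  define b where "b = r div 4"
  have b: "b \<le> 4" using r by (simp add: b_def)
  have blk: "unvec_block v b = 0"
    using assms(2)[of "4 - b"] b by (simp add: level_eq)
  have "r = 4 * b \<or> r = 4 * b + 1 \<or> r = 4 * b + 2 \<or> r = 4 * b + 3"
    unfolding b_def by presburger
  then show "vec_index v r = vec_index (0\<^sub>v 20) r"
    using arg_cong[OF blk, of "\<lambda>M. M $ 1 $ 1"] arg_cong[OF blk, of "\<lambda>M. M $ 2 $ 1"]
      arg_cong[OF blk, of "\<lambda>M. M $ 1 $ 2"] arg_cong[OF blk, of "\<lambda>M. M $ 2 $ 2"] r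
    by auto
qed (use assms in simp)

text \<open>An eigenvector is a solution of the scheme that is multiplied by \<open>z\<close> at each time step. This form holds
  for \<open>z = 0\<close> too, because all levels are expressed through the oldest one, without division.\<close>

lemma eigenvalue_levels:
  assumes pos: "T1 > 0" "T2 > 0" "\<Delta>t > 0"
    and ev: "eigenvalue (amplification_matrix m T1 T2 \<Omega> \<Delta>t) z"
  obtains \<rho> where "\<rho> 0 \<noteq> 0" "\<And>j. j \<le> 4 \<Longrightarrow> \<rho> j = z ^ j *\<^sub>C \<rho> 0"
    "picard_iterate m T1 T2 \<Omega> \<Delta>t \<rho> 4 = z ^ 5 *\<^sub>C \<rho> 0"
proof -
  have dim: "dim_row (amplification_matrix m T1 T2 \<Omega> \<Delta>t) = 20"
    by (simp add: amplification_matrix_def)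
  obtain v where v: "v \<in> carrier_vec 20" "v \<noteq> 0\<^sub>v 20"
    and eq: "amplification_matrix m T1 T2 \<Omega> \<Delta>t *\<^sub>v v = z \<cdot>\<^sub>v v"
    using ev by (auto simp: eigenvalue_def eigenvector_def dim)
  have form: "scheme_form m T1 T2 \<Omega> \<Delta>t v r = z * vec_index v r" if "r < 20" for r
    using amplification_matrix_mult[OF pos v(1) that, of m \<Omega>] that v(1) by (simp add: eq)
  have geo: "level v j = z ^ j *\<^sub>C level v 0" if "j \<le> 4" for j
    by (rule level_geometric[OF _ that]) (metis form scheme_form_shift)
  have "level v 0 \<noteq> 0"
  proof
    assume "level v 0 = 0"
    then have "level v j = 0" if "j \<le> 4" for j
      using geo[OF that] by (simp add: cmat2_eqI)
    then show False
      using vec_zero_if_levels_zero[OF v(1)] v(2) by blast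
  qed
  moreover have "picard_iterate m T1 T2 \<Omega> \<Delta>t (level v) 4 = z *\<^sub>C level v 4"
    by (rule cmat2_eqI)
      (use form[of 0] form[of 1] form[of 2] form[of 3] in
        \<open>simp_all add: scheme_form_head level_eq del: picard_iterate.simps One_nat_def flip: numeral_2_eq_2\<close>)
  then have "picard_iterate m T1 T2 \<Omega> \<Delta>t (level v) 4 = z ^ 5 *\<^sub>C level v 0"
    by (subst (asm) geo[of 4]) (auto intro!: cmat2_eqI simp: eval_nat_numeral)
  ultimately show ?thesis
    using that geo by blast
qed


section \<open>Bounding the spectrum\<close>

lemma cmod_le_one_if_power:
  fixes z :: complex
  assumes "cmod (z ^ n) \<le> 1" "n > 0"
  shows "cmod z \<le> 1"
  using assms by (simp add: norm_power power_le_one_iff)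

theorem theorem5p1:
  fixes T1 T2 \<Delta>t \<Omega> :: real and m :: flow_kind
  assumes "T1 > 0" and "T2 > 0" and "\<Delta>t > 0"
    and "\<forall>z::complex.
          z ^ 5
          - (\<Sum>k=1..5. z ^ (5 - k) * of_real (gregory_weight (5 - k) * B_const T2 \<Delta>t * (\<Delta>t / T2)
                          * (cmod (stability_factor m T1 T2 \<Omega> \<Delta>t k))\<^sup>2))
          - z ^ 4 * of_real (gregory_weight 5 ^ 4 * (\<Delta>t / T2) ^ 4)
          - of_real (B_const T2 \<Delta>t * (cmod (stability_factor m T1 T2 \<Omega> \<Delta>t 5))\<^sup>2) = 0
          \<longrightarrow> cmod z \<le> 1"
    and "cmod (stability_factor m T1 T2 \<Omega> \<Delta>t 5) \<le> 1"
  shows "scheme_stable m T1 T2 \<Omega> \<Delta>t"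
proof -
  note pos = assms(1-3)
  let ?A = "amplification_matrix m T1 T2 \<Omega> \<Delta>t"
  let ?s = "stability_factor m T1 T2 \<Omega> \<Delta>t"
  let ?q = "gregory_weight 5 * (\<Delta>t / T2)"
  have bound: "cmod z \<le> 1" if ev: "eigenvalue ?A z" for z
  proof -
    obtain \<rho> where nz: "\<rho> 0 \<noteq> 0"
      and geo: "\<And>j. j \<le> 4 \<Longrightarrow> \<rho> j = z ^ j *\<^sub>C \<rho> 0"
      and step: "picard_iterate m T1 T2 \<Omega> \<Delta>t \<rho> 4 = z ^ 5 *\<^sub>C \<rho> 0"
      using eigenvalue_levels[OF pos ev] by blast
    have entry: "z ^ 5 * \<rho> 0 $ a $ b = picard_iterate m T1 T2 \<Omega> \<Delta>t \<rho> (Suc 3) $ a $ b" for a b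
      using arg_cong[OF step, of "\<lambda>M. M $ a $ b"] by (simp del: picard_iterate.simps)
    show ?thesis
    proof (cases "\<rho> 0 $ 2 $ 2 = 0")
      case False
      \<comment> \<open>a nonzero excited population: \<open>z\<close> is a root of the given polynomial\<close>
      let ?x = "\<rho> 0 $ 2 $ 2"
      let ?S = "\<Sum>j=0..4. of_real (gregory_weight j * (\<Delta>t / T2) * (cmod (?s (5 - j)))\<^sup>2) * z ^ j"
      have upd: "population_update m T1 T2 \<Omega> \<Delta>t (\<lambda>j. \<rho> j $ 2 $ 2)
          = (of_real ((cmod (?s 5))\<^sup>2) + ?S) * ?x"
      proof -
        have "(\<Sum>j=0..4. of_real (gregory_weight j * (\<Delta>t / T2) * (cmod (?s (5 - j)))\<^sup>2) * \<rho> j $ 2 $ 2)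
            = ?S * ?x"
          unfolding sum_distrib_right by (intro sum.cong refl) (subst geo, simp_all)
        then show ?thesis
          unfolding population_update_def distrib_right by simp
      qed
      have "z ^ 5 * ?x = picard_iterate m T1 T2 \<Omega> \<Delta>t \<rho> 4 $ 2 $ 2"
        using step by simp
      also have "\<dots> = (of_real (B_const T2 \<Delta>t) * (of_real ((cmod (?s 5))\<^sup>2) + ?S)
          + of_real (?q ^ 4) * z ^ 4) * ?x"
        unfolding picard_22[OF pos] B_const_eq[symmetric] upd
        using geo[of 4] by (simp add: algebra_simps)
      finally have root: "z ^ 5 = of_real (B_const T2 \<Delta>t) * (of_real ((cmod (?s 5))\<^sup>2) + ?S)
          + of_real (?q ^ 4) * z ^ 4"
        using False by simp
      \<comment> \<open>reindexing by \<open>j = 5 - k\<close>: from steps back in time to levels\<close>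
      have "(\<Sum>k=1..5. z ^ (5 - k) * of_real (gregory_weight (5 - k) * B_const T2 \<Delta>t * (\<Delta>t / T2)
              * (cmod (?s k))\<^sup>2)) = of_real (B_const T2 \<Delta>t) * ?S"
        unfolding sum_distrib_left
        by (rule sum.reindex_bij_witness[of _ "\<lambda>j. 5 - j" "\<lambda>k. 5 - k"]) auto
      then have "z ^ 5
          - (\<Sum>k=1..5. z ^ (5 - k) * of_real (gregory_weight (5 - k) * B_const T2 \<Delta>t * (\<Delta>t / T2)
                          * (cmod (?s k))\<^sup>2))
          - z ^ 4 * of_real (gregory_weight 5 ^ 4 * (\<Delta>t / T2) ^ 4)
          - of_real (B_const T2 \<Delta>t * (cmod (?s 5))\<^sup>2) = 0"
        unfolding root power_mult_distrib by (simp add: algebra_simps)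
      then show ?thesis
        using assms(4) by blast
    next
      case True
      \<comment> \<open>no excited population at any level, so only the homogeneous flow remains\<close>
      have pop: "\<rho> j $ 2 $ 2 = 0" if "j \<le> 4" for j
        using True by (simp add: geo[OF that])
      consider "\<rho> 0 $ 1 $ 2 \<noteq> 0" | "\<rho> 0 $ 2 $ 1 \<noteq> 0" | "\<rho> 0 $ 1 $ 1 \<noteq> 0"
        using nz True cmat2_eqI[of "\<rho> 0" 0] by auto
      then have "cmod (z ^ 5) \<le> 1"
      proof cases
        case 1
        then have "z ^ 5 = cnj (?s 5)"
          using entry[of 1 2] unfolding picard_Suc_offdiagonal[OF pos] by simp
        then show ?thesis
          using assms(5) by simp
      next
        case 2
        then have "z ^ 5 = ?s 5"
          using entry[of 2 1] unfolding picard_Suc_offdiagonal[OF pos] by simp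
        then show ?thesis
          using assms(5) by simp
      next
        case 3
        have "population_update m T1 T2 \<Omega> \<Delta>t (\<lambda>j. \<rho> j $ 2 $ 2) = 0"
          by (simp add: population_update_def pop)
        then have "picard_iterate m T1 T2 \<Omega> \<Delta>t \<rho> 3 $ 2 $ 2 = 0"
          by (simp add: picard_22[OF pos] pop)
        then have "z ^ 5 = 1"
          using 3 entry[of 1 1] unfolding picard_Suc_11[OF pos] by (simp add: pop)
        then show ?thesis
          by simp
      qed
      then show ?thesis
        by (rule cmod_le_one_if_power) simp
    qed
  qed
  have "?A \<in> carrier_mat 20 20"
    by (simp add: amplification_matrix_def)
  then have "spectral_radius ?A \<in> cmod ` spectrum ?A"
    by (rule spectral_radius_mem_max(1)) simp
  then show ?thesis
    using bound by (auto simp: scheme_stable_def spectrum_def)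
qed

end
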